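(* Let $F$ be a field. (a) Let $D$ and $D'$ be two central simple $F$-algebras and let $g,h:D\to D'$ be two $F$-algebra isomorphisms. Let $c\in D^\times$, $\sigma_i\in\mathrm{Aut}_F(D)$, $\phi_i\in\mathrm{Aut}_F(D')$ $(i=1,2,3,4)$, $b\in F^\times$, and let $A=\mathrm{Cay}(D,c,\sigma_1,\sigma_2,\sigma_3,\sigma_4)$ and $B=\mathrm{Cay}(D',g(c)b^2,\phi_1,\phi_2,\phi_3,\phi_4)$. If $\phi_i=g\circ\sigma_i\circ h^{-1}$ for $i=1,2$ and $\phi_i=h\circ\sigma_i\circ g^{-1}$ for $i=3,4$, then the map $G:A\to B$, $G(u,v)=(g(u),h(v)b^{-1})$, is an $F$-algebra isomorphism. (b) Let $K$ and $L$ be finite field extensions of $F$ and let $g,h:K\to L$ be two $F$-algebra isomorphisms. Let $c\in K^\times$, $\sigma_i\in\mathrm{Aut}_F(K)$, $\phi_i\in\mathrm{Aut}_F(L)$ $(i=1,2,3,4)$, $b\in L^\times$, and let $A=\mathrm{Cay}(K,c,\sigma_1,\sigma_2,\sigma_3,\sigma_4)$ and $B=\mathrm{Cay}(L,g(c)\phi_1(b)\phi_2(b),\phi_1,\phi_2,\phi_3,\phi_4)$. If $\phi_i=g\circ\sigma_i\circ h^{-1}$ for $i=1,2$ and $\phi_i=h\circ\sigma_i\circ g^{-1}$ for $i=3,4$, then the map $G:A\to B$, $G(u,v)=(g(u),h(v)b^{-1})$, is an $F$-algebra isomorphism.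
   Context: For $E$ a central simple associative $F$-algebra or a finite field extension of $F$, $c\in E^\times$ and $\sigma_i\in\mathrm{Aut}_F(E)$, $\mathrm{Cay}(E,c,\sigma_1,\sigma_2,\sigma_3,\sigma_4)$ denotes the $F$-vector space $E\oplus E$ with the (not necessarily associative) multiplication $(u,v)(x,y)=(ux+c\sigma_1(v)\sigma_2(y),\ \sigma_3(u)y+v\sigma_4(x))$. *)

theory Defs
  imports "HOL-Algebra.Algebra"
begin

text \<open>
  An algebra over a field is an HOL-Algebra module record (a ring record extended by a scalar
  multiplication). Multiplication need not be associative in general.
\<close>

locale unital_algebra = module F A for F (structure) and A (structure) +
  assumes mult_closed: "\<lbrakk>x \<in> carrier A; y \<in> carrier A\<rbrakk> \<Longrightarrow> x \<otimes>\<^bsub>A\<^esub> y \<in> carrier A"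
    and mult_l_distr: "\<lbrakk>x \<in> carrier A; y \<in> carrier A; z \<in> carrier A\<rbrakk> \<Longrightarrow>
      (x \<oplus>\<^bsub>A\<^esub> y) \<otimes>\<^bsub>A\<^esub> z = x \<otimes>\<^bsub>A\<^esub> z \<oplus>\<^bsub>A\<^esub> y \<otimes>\<^bsub>A\<^esub> z"
    and mult_r_distr: "\<lbrakk>x \<in> carrier A; y \<in> carrier A; z \<in> carrier A\<rbrakk> \<Longrightarrow>
      z \<otimes>\<^bsub>A\<^esub> (x \<oplus>\<^bsub>A\<^esub> y) = z \<otimes>\<^bsub>A\<^esub> x \<oplus>\<^bsub>A\<^esub> z \<otimes>\<^bsub>A\<^esub> y"
    and smult_mult_l: "\<lbrakk>a \<in> carrier F; x \<in> carrier A; y \<in> carrier A\<rbrakk> \<Longrightarrow>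
      (a \<odot>\<^bsub>A\<^esub> x) \<otimes>\<^bsub>A\<^esub> y = a \<odot>\<^bsub>A\<^esub> (x \<otimes>\<^bsub>A\<^esub> y)"
    and smult_mult_r: "\<lbrakk>a \<in> carrier F; x \<in> carrier A; y \<in> carrier A\<rbrakk> \<Longrightarrow>
      x \<otimes>\<^bsub>A\<^esub> (a \<odot>\<^bsub>A\<^esub> y) = a \<odot>\<^bsub>A\<^esub> (x \<otimes>\<^bsub>A\<^esub> y)"
    and unit_closed: "\<one>\<^bsub>A\<^esub> \<in> carrier A"
    and unit_l: "x \<in> carrier A \<Longrightarrow> \<one>\<^bsub>A\<^esub> \<otimes>\<^bsub>A\<^esub> x = x"
    and unit_r: "x \<in> carrier A \<Longrightarrow> x \<otimes>\<^bsub>A\<^esub> \<one>\<^bsub>A\<^esub> = x"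

locale assoc_algebra = unital_algebra F A + ring A for F (structure) and A (structure)

definition scalars :: "('f, 'n) ring_scheme \<Rightarrow> ('f, 'a, 'm) module_scheme \<Rightarrow> 'a set"
  where "scalars F A = (\<lambda>a. a \<odot>\<^bsub>A\<^esub> \<one>\<^bsub>A\<^esub>) ` carrier F"

definition ring_center :: "('a, 'm) ring_scheme \<Rightarrow> 'a set"
  where "ring_center A = {z \<in> carrier A. \<forall>x \<in> carrier A. z \<otimes>\<^bsub>A\<^esub> x = x \<otimes>\<^bsub>A\<^esub> z}"

text \<open>
  Finite dimension over \<open>F\<close> is expressed by the library's notion of dimension over a subfield,
  applied to the copy \<open>scalars F A\<close> of \<open>F\<close> inside \<open>A\<close>. The library's \<open>ideal\<close> is two-sided.
\<close>

locale central_simple_algebra =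
  assoc_algebra F A + F: field F for F (structure) and A (structure) +
  assumes finite_dim: "ring.finite_dimension A (scalars F A) (carrier A)"
    and central: "ring_center A = scalars F A"
    and nontrivial: "carrier A \<noteq> {\<zero>\<^bsub>A\<^esub>}"
    and simple: "ideal I A \<Longrightarrow> I = {\<zero>\<^bsub>A\<^esub>} \<or> I = carrier A"

locale finite_field_extension =
  algebra F K + F: field F + K: field K for F (structure) and K (structure) +
  assumes finite_dim: "ring.finite_dimension K (scalars F K) (carrier K)"

text \<open>
  Preservation of \<open>\<one>\<close>, which is part of \<^const>\<open>ring_iso\<close>, is automatic for bijective multiplicative
  maps between algebras with a unit.
\<close>

definition alg_isos ::
  "('f, 'n) ring_scheme \<Rightarrow> ('f, 'a, 'm) module_scheme \<Rightarrow> ('f, 'b, 'k) module_scheme \<Rightarrow> ('a \<Rightarrow> 'b) set"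
  where "alg_isos F A B =
    {f \<in> ring_iso A B. \<forall>a \<in> carrier F. \<forall>x \<in> carrier A. f (a \<odot>\<^bsub>A\<^esub> x) = a \<odot>\<^bsub>B\<^esub> f x}"

abbreviation alg_auts :: "('f, 'n) ring_scheme \<Rightarrow> ('f, 'a, 'm) module_scheme \<Rightarrow> ('a \<Rightarrow> 'a) set"
  where "alg_auts F A \<equiv> alg_isos F A A"

definition Cay ::
  "('f, 'e, 'm) module_scheme \<Rightarrow> 'e \<Rightarrow> ('e \<Rightarrow> 'e) \<Rightarrow> ('e \<Rightarrow> 'e) \<Rightarrow> ('e \<Rightarrow> 'e) \<Rightarrow> ('e \<Rightarrow> 'e)
    \<Rightarrow> ('f, 'e \<times> 'e) module"
  where "Cay E c \<sigma>1 \<sigma>2 \<sigma>3 \<sigma>4 =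
    \<lparr> carrier = carrier E \<times> carrier E,
      monoid.mult = (\<lambda>(u, v) (x, y).
        (u \<otimes>\<^bsub>E\<^esub> x \<oplus>\<^bsub>E\<^esub> c \<otimes>\<^bsub>E\<^esub> \<sigma>1 v \<otimes>\<^bsub>E\<^esub> \<sigma>2 y, \<sigma>3 u \<otimes>\<^bsub>E\<^esub> y \<oplus>\<^bsub>E\<^esub> v \<otimes>\<^bsub>E\<^esub> \<sigma>4 x)),
      one = (\<one>\<^bsub>E\<^esub>, \<zero>\<^bsub>E\<^esub>),
      ring.zero = (\<zero>\<^bsub>E\<^esub>, \<zero>\<^bsub>E\<^esub>),
      add = (\<lambda>(u, v) (x, y). (u \<oplus>\<^bsub>E\<^esub> x, v \<oplus>\<^bsub>E\<^esub> y)),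
      smult = (\<lambda>a (u, v). (a \<odot>\<^bsub>E\<^esub> u, a \<odot>\<^bsub>E\<^esub> v)) \<rparr>"

lemma alg_isosD:
  assumes "f \<in> alg_isos F A B"
  shows "\<And>x. x \<in> carrier A \<Longrightarrow> f x \<in> carrier B"
    and "\<And>x y. \<lbrakk>x \<in> carrier A; y \<in> carrier A\<rbrakk> \<Longrightarrow> f (x \<otimes>\<^bsub>A\<^esub> y) = f x \<otimes>\<^bsub>B\<^esub> f y"
    and "\<And>x y. \<lbrakk>x \<in> carrier A; y \<in> carrier A\<rbrakk> \<Longrightarrow> f (x \<oplus>\<^bsub>A\<^esub> y) = f x \<oplus>\<^bsub>B\<^esub> f y"
    and "f \<one>\<^bsub>A\<^esub> = \<one>\<^bsub>B\<^esub>"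
    and "\<And>a x. \<lbrakk>a \<in> carrier F; x \<in> carrier A\<rbrakk> \<Longrightarrow> f (a \<odot>\<^bsub>A\<^esub> x) = a \<odot>\<^bsub>B\<^esub> f x"
    and "bij_betw f (carrier A) (carrier B)"
  using assms by (auto simp: alg_isos_def dest: ring_iso_memE)

lemma (in assoc_algebra) alg_auts_zero:
  assumes "f \<in> alg_auts F A" shows "f \<zero>\<^bsub>A\<^esub> = \<zero>\<^bsub>A\<^esub>"
proof -
  have "f \<zero>\<^bsub>A\<^esub> \<oplus>\<^bsub>A\<^esub> f \<zero>\<^bsub>A\<^esub> = f \<zero>\<^bsub>A\<^esub>"
    using alg_isosD(3)[OF assms, of "\<zero>\<^bsub>A\<^esub>" "\<zero>\<^bsub>A\<^esub>"] by simp
  thus ?thesis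
    using alg_isosD(1)[OF assms, of "\<zero>\<^bsub>A\<^esub>"]
    by (metis M.add.r_cancel_one M.zero_closed)
qed

lemma (in assoc_algebra) Cay_unital_algebra:
  assumes c: "c \<in> carrier A"
    and s: "s1 \<in> alg_auts F A" "s2 \<in> alg_auts F A" "s3 \<in> alg_auts F A" "s4 \<in> alg_auts F A"
  shows "unital_algebra F (Cay A c s1 s2 s3 s4)"
proof -
  note cl = s[THEN alg_isosD(1)] and ad = s[THEN alg_isosD(3)]
    and on = s[THEN alg_isosD(4)] and sm = s[THEN alg_isosD(5)] and ze = s[THEN alg_auts_zero]
  have grp: "abelian_group (Cay A c s1 s2 s3 s4)"
  proof (rule abelian_groupI)
    fix x assume "x \<in> carrier (Cay A c s1 s2 s3 s4)"
    then obtain u v where x: "x = (u, v)" "u \<in> carrier A" "v \<in> carrier A"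
      by (auto simp: Cay_def)
    show "\<exists>y \<in> carrier (Cay A c s1 s2 s3 s4).
        y \<oplus>\<^bsub>Cay A c s1 s2 s3 s4\<^esub> x = \<zero>\<^bsub>Cay A c s1 s2 s3 s4\<^esub>"
      using x by (intro bexI[of _ "(\<ominus>\<^bsub>A\<^esub> u, \<ominus>\<^bsub>A\<^esub> v)"]) (auto simp: Cay_def M.l_neg)
  qed (auto simp: Cay_def M.a_ac)
  have md: "module F (Cay A c s1 s2 s3 s4)"
    by (rule moduleI[OF R.is_cring grp])
      (auto simp: Cay_def smult_l_distr smult_r_distr smult_assoc1)
  show ?thesis
    by (intro unital_algebra.intro[OF md] unital_algebra_axioms.intro)
      (auto simp: Cay_def cl ad on sm ze c l_distr r_distr M.a_ac smult_mult_l smult_mult_r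
        smult_r_distr)
qed

end

theory Submission
  imports Defs
begin

text \<open>
  Both parts are instances of one fact (theorem \<open>Cay_isomorphism\<close>) about isomorphisms
  \<open>g, h : A \<rightarrow> B\<close> of unital associative algebras with \<open>\<phi>i \<circ> h = g \<circ> \<sigma>i\<close> for \<open>i = 1, 2\<close> and
  \<open>\<phi>i \<circ> g = h \<circ> \<sigma>i\<close> for \<open>i = 3, 4\<close>: if \<open>d\<close> is a central unit of \<open>B\<close>, then
  \<open>(u, v) \<mapsto> (g u, h v d\<inverse>)\<close> is an isomorphism from \<open>Cay A c \<sigma>1 \<sigma>2 \<sigma>3 \<sigma>4\<close> onto
  \<open>Cay B (g c \<cdot> \<phi>1 d \<cdot> \<phi>2 d) \<phi>1 \<phi>2 \<phi>3 \<phi>4\<close>. Applying \<open>\<phi>1\<close> and \<open>\<phi>2\<close> to second components that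
  carry the factor \<open>d\<inverse>\<close> produces \<open>\<phi>1 d\<inverse>\<close> and \<open>\<phi>2 d\<inverse>\<close>, which the factor \<open>\<phi>1 d \<cdot> \<phi>2 d\<close> of the new
  constant cancels (lemma \<open>cancel_central_pair\<close>), because automorphisms preserve the centre (lemma
  \<open>alg_iso_ring_center\<close>). In the second component of a product each summand carries \<open>d\<inverse>\<close> exactly
  once, and centrality moves it to the right end.

  For central simple algebras the central unit is the scalar \<open>d = b \<cdot> 1\<close>; it is fixed by
  \<open>\<phi>1\<close> and \<open>\<phi>2\<close>, so the new constant becomes \<open>b\<^sup>2 \<cdot> g c\<close>. For field extensions every unit is central,
  and \<open>d = b\<close>.
\<close>

lemma (in ring) mult_unit_bij:
  assumes "e \<in> Units R"
  shows "bij_betw (\<lambda>x. x \<otimes> e) (carrier R) (carrier R)"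
  by (rule bij_betw_byWitness[where f' = "\<lambda>x. x \<otimes> inv e"]) (use assms in \<open>auto simp: m_assoc Units_closed\<close>)

lemma ring_centerD:
  assumes "z \<in> ring_center A"
  shows "z \<in> carrier A" and "x \<in> carrier A \<Longrightarrow> z \<otimes>\<^bsub>A\<^esub> x = x \<otimes>\<^bsub>A\<^esub> z"
  using assms by (auto simp: ring_center_def)

lemma (in ring) inv_in_ring_center:
  assumes "d \<in> Units R" "d \<in> ring_center R"
  shows "inv d \<in> ring_center R"
proof -
  have "inv d \<otimes> x = x \<otimes> inv d" if x: "x \<in> carrier R" for x
  proof -
    have "inv d \<otimes> x = inv d \<otimes> (x \<otimes> d) \<otimes> inv d"
      using assms x by (simp add: m_assoc Units_closed)
    also have "x \<otimes> d = d \<otimes> x"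
      using ring_centerD(2)[OF assms(2) x] by simp
    also have "inv d \<otimes> (d \<otimes> x) = x"
      using assms x by (simp add: Units_closed flip: m_assoc)
    finally show ?thesis .
  qed
  then show ?thesis
    using assms(1) by (simp add: ring_center_def)
qed

text \<open>
  Surjectivity makes every element of \<open>B\<close> an image \<open>f x\<close>, and \<open>z\<close> commutes with \<open>x\<close>.
\<close>

lemma alg_iso_ring_center:
  assumes f: "f \<in> alg_isos F A B" and z: "z \<in> ring_center A"
  shows "f z \<in> ring_center B"
proof -
  have "f z \<otimes>\<^bsub>B\<^esub> y = y \<otimes>\<^bsub>B\<^esub> f z" if "y \<in> carrier B" for y
  proof -
    obtain x where x: "x \<in> carrier A" "y = f x"
      using \<open>y \<in> carrier B\<close> alg_isosD(6)[OF f] by (auto simp: bij_betw_def)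
    then show ?thesis
      using alg_isosD(2)[OF f] ring_centerD[OF z] by metis
  qed
  then show ?thesis
    using alg_isosD(1)[OF f] ring_centerD(1)[OF z] by (simp add: ring_center_def)
qed

text \<open>
  Centrality carries \<open>d1\<close> and \<open>d2\<close> past \<open>x\<close> and \<open>y\<close> until each stands directly to the right of its
  left inverse, where it cancels.
\<close>

lemma (in ring) cancel_central_pair:
  assumes d: "d1 \<in> ring_center R" "d2 \<in> ring_center R"
    and e: "e1 \<in> carrier R" "e2 \<in> carrier R" "e1 \<otimes> d1 = \<one>" "e2 \<otimes> d2 = \<one>"
    and x: "a \<in> carrier R" "x \<in> carrier R" "y \<in> carrier R"
  shows "a \<otimes> d1 \<otimes> d2 \<otimes> (x \<otimes> e1) \<otimes> (y \<otimes> e2) = a \<otimes> x \<otimes> y"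
proof -
  note [simp] = ring_centerD(1)[OF d(1)] ring_centerD(1)[OF d(2)]
  have "a \<otimes> d1 \<otimes> d2 \<otimes> (x \<otimes> e1) \<otimes> (y \<otimes> e2)
      = a \<otimes> (d1 \<otimes> (d2 \<otimes> (x \<otimes> e1 \<otimes> (y \<otimes> e2))))"
    using e x by (simp add: m_assoc)
  also have "d2 \<otimes> (x \<otimes> e1 \<otimes> (y \<otimes> e2)) = x \<otimes> e1 \<otimes> (y \<otimes> e2) \<otimes> d2"
    by (rule ring_centerD(2)[OF d(2)]) (use e x in simp)
  also have "\<dots> = x \<otimes> e1 \<otimes> y"
    using e x by (simp add: m_assoc)
  also have "d1 \<otimes> (x \<otimes> e1 \<otimes> y) = (d1 \<otimes> (x \<otimes> e1)) \<otimes> y"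
    using e x by (simp add: m_assoc)
  also have "d1 \<otimes> (x \<otimes> e1) = x \<otimes> e1 \<otimes> d1"
    by (rule ring_centerD(2)[OF d(1)]) (use e x in simp)
  also have "\<dots> = x"
    using e x by (simp add: m_assoc)
  finally show ?thesis
    using x by (simp add: m_assoc)
qed

text \<open>
  The map \<open>k\<close> has to be \<open>h\<close> times \<open>d\<inverse>\<close> on the carrier only, because outside of it multiplication by
  a scalar and multiplication by the corresponding element of \<open>B\<close> may differ.
\<close>

theorem Cay_isomorphism:
  assumes A: "assoc_algebra F A" and B: "assoc_algebra F B"
    and g: "g \<in> alg_isos F A B" and h: "h \<in> alg_isos F A B"
    and c: "c \<in> carrier A" and d: "d \<in> Units B" "d \<in> ring_center B"
    and s: "s1 \<in> alg_auts F A" "s2 \<in> alg_auts F A" "s3 \<in> alg_auts F A" "s4 \<in> alg_auts F A"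
    and p: "p1 \<in> alg_auts F B" "p2 \<in> alg_auts F B"
    and hg: "\<And>x. x \<in> carrier A \<Longrightarrow> p1 (h x) = g (s1 x)" "\<And>x. x \<in> carrier A \<Longrightarrow> p2 (h x) = g (s2 x)"
    and gh: "\<And>x. x \<in> carrier A \<Longrightarrow> p3 (g x) = h (s3 x)" "\<And>x. x \<in> carrier A \<Longrightarrow> p4 (g x) = h (s4 x)"
    and k: "\<And>x. x \<in> carrier A \<Longrightarrow> k x = h x \<otimes>\<^bsub>B\<^esub> inv\<^bsub>B\<^esub> d"
  shows "(\<lambda>(u, v). (g u, k v))
    \<in> alg_isos F (Cay A c s1 s2 s3 s4) (Cay B (g c \<otimes>\<^bsub>B\<^esub> p1 d \<otimes>\<^bsub>B\<^esub> p2 d) p1 p2 p3 p4)"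
    (is "?G \<in> alg_isos F ?A ?B")
proof -
  interpret A: assoc_algebra F A by (rule A)
  interpret B: assoc_algebra F B by (rule B)
  define e where "e = inv\<^bsub>B\<^esub> d"
  have eU: "e \<in> Units B" and eC: "e \<in> ring_center B"
    using d B.inv_in_ring_center by (simp_all add: e_def)
  have e: "e \<in> carrier B" and dB: "d \<in> carrier B" and ed: "e \<otimes>\<^bsub>B\<^esub> d = \<one>\<^bsub>B\<^esub>"
    using d by (simp_all add: e_def B.Units_closed)
  note gs = alg_isosD(1-5)[OF g] and hs = alg_isosD(1-5)[OF h]
    and scl = s[THEN alg_isosD(1)]
    and pcl = p[THEN alg_isosD(1)]
  have G: "?G = map_prod g k"
    by auto
  have k: "k x = h x \<otimes>\<^bsub>B\<^esub> e" if "x \<in> carrier A" for x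
    using k[OF that] by (simp add: e_def)
  have h_zero: "h \<zero>\<^bsub>A\<^esub> = \<zero>\<^bsub>B\<^esub>"
  proof -
    have "h \<zero>\<^bsub>A\<^esub> \<oplus>\<^bsub>B\<^esub> h \<zero>\<^bsub>A\<^esub> = h \<zero>\<^bsub>A\<^esub>"
      using hs(3)[of "\<zero>\<^bsub>A\<^esub>" "\<zero>\<^bsub>A\<^esub>"] by simp
    then show ?thesis
      using hs(1)[of "\<zero>\<^bsub>A\<^esub>"] by (metis A.M.zero_closed B.M.add.r_cancel_one)
  qed
  have first: "g c \<otimes>\<^bsub>B\<^esub> p1 d \<otimes>\<^bsub>B\<^esub> p2 d \<otimes>\<^bsub>B\<^esub> p1 (h v \<otimes>\<^bsub>B\<^esub> e) \<otimes>\<^bsub>B\<^esub> p2 (h y \<otimes>\<^bsub>B\<^esub> e)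
      = g (c \<otimes>\<^bsub>A\<^esub> s1 v \<otimes>\<^bsub>A\<^esub> s2 y)" if v: "v \<in> carrier A" and y: "y \<in> carrier A" for v y
  proof -
    have "p1 e \<otimes>\<^bsub>B\<^esub> p1 d = \<one>\<^bsub>B\<^esub>" "p2 e \<otimes>\<^bsub>B\<^esub> p2 d = \<one>\<^bsub>B\<^esub>"
      using p[THEN alg_isosD(2), OF e dB] p[THEN alg_isosD(4)] ed by simp_all
    then have "g c \<otimes>\<^bsub>B\<^esub> p1 d \<otimes>\<^bsub>B\<^esub> p2 d \<otimes>\<^bsub>B\<^esub> (g (s1 v) \<otimes>\<^bsub>B\<^esub> p1 e) \<otimes>\<^bsub>B\<^esub> (g (s2 y) \<otimes>\<^bsub>B\<^esub> p2 e)
        = g c \<otimes>\<^bsub>B\<^esub> g (s1 v) \<otimes>\<^bsub>B\<^esub> g (s2 y)"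
      by (intro B.cancel_central_pair p[THEN alg_iso_ring_center, OF d(2)])
        (simp_all add: e c v y scl pcl gs)
    then show ?thesis
      using v y c by (simp add: p[THEN alg_isosD(2)] hs e hg gs scl)
  qed
  have second: "p3 (g u) \<otimes>\<^bsub>B\<^esub> (h y \<otimes>\<^bsub>B\<^esub> e) \<oplus>\<^bsub>B\<^esub> (h v \<otimes>\<^bsub>B\<^esub> e) \<otimes>\<^bsub>B\<^esub> p4 (g x)
      = h (s3 u \<otimes>\<^bsub>A\<^esub> y \<oplus>\<^bsub>A\<^esub> v \<otimes>\<^bsub>A\<^esub> s4 x) \<otimes>\<^bsub>B\<^esub> e"
    if "u \<in> carrier A" "v \<in> carrier A" "x \<in> carrier A" "y \<in> carrier A" for u v x y
    using that e ring_centerD(2)[OF eC, of "h (s4 x)"]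
    by (simp add: gh hs scl B.l_distr B.m_assoc)
  have "bij_betw (\<lambda>v. h v \<otimes>\<^bsub>B\<^esub> e) (carrier A) (carrier B)"
    using bij_betw_trans[OF alg_isosD(6)[OF h] B.mult_unit_bij[OF eU]] by (simp add: comp_def)
  then have "bij_betw k (carrier A) (carrier B)"
    using bij_betw_cong[of "carrier A" k] k by simp
  then have bij: "bij_betw ?G (carrier ?A) (carrier ?B)"
    unfolding G Cay_def by (simp add: bij_betw_map_prod alg_isosD(6)[OF g])
  have "?G \<in> ring_hom ?A ?B"
    unfolding G
    by (rule ring_hom_memI)
      (auto simp: Cay_def first second k gs hs h_zero e c scl B.l_distr)
  then have "?G \<in> ring_iso ?A ?B"
    using bij by (simp add: ring_iso_def)
  moreover have "?G (a \<odot>\<^bsub>?A\<^esub> x) = a \<odot>\<^bsub>?B\<^esub> ?G x" if "a \<in> carrier F" "x \<in> carrier ?A" for a x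
    using that unfolding G by (auto simp: Cay_def k gs hs e B.smult_mult_l)
  ultimately show ?thesis
    unfolding alg_isos_def by blast
qed

lemma (in assoc_algebra) scalar_in_ring_center:
  assumes "a \<in> carrier F"
  shows "a \<odot>\<^bsub>A\<^esub> \<one>\<^bsub>A\<^esub> \<in> ring_center A"
  using assms by (simp add: ring_center_def smult_mult_l smult_mult_r)

lemma (in assoc_algebra) scalar_unit:
  assumes b: "b \<in> Units F"
  shows "b \<odot>\<^bsub>A\<^esub> \<one>\<^bsub>A\<^esub> \<in> Units A"
    and "inv\<^bsub>A\<^esub> (b \<odot>\<^bsub>A\<^esub> \<one>\<^bsub>A\<^esub>) = inv\<^bsub>F\<^esub> b \<odot>\<^bsub>A\<^esub> \<one>\<^bsub>A\<^esub>"
proof -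
  have "(b \<odot>\<^bsub>A\<^esub> \<one>\<^bsub>A\<^esub>) \<otimes>\<^bsub>A\<^esub> (inv\<^bsub>F\<^esub> b \<odot>\<^bsub>A\<^esub> \<one>\<^bsub>A\<^esub>) = \<one>\<^bsub>A\<^esub>"
    "(inv\<^bsub>F\<^esub> b \<odot>\<^bsub>A\<^esub> \<one>\<^bsub>A\<^esub>) \<otimes>\<^bsub>A\<^esub> (b \<odot>\<^bsub>A\<^esub> \<one>\<^bsub>A\<^esub>) = \<one>\<^bsub>A\<^esub>"
    using b by (simp_all add: smult_mult_l R.Units_closed flip: smult_assoc1)
  moreover have "b \<odot>\<^bsub>A\<^esub> \<one>\<^bsub>A\<^esub> \<in> carrier A" "inv\<^bsub>F\<^esub> b \<odot>\<^bsub>A\<^esub> \<one>\<^bsub>A\<^esub> \<in> carrier A"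
    using b by (simp_all add: R.Units_closed)
  ultimately show "b \<odot>\<^bsub>A\<^esub> \<one>\<^bsub>A\<^esub> \<in> Units A"
    and "inv\<^bsub>A\<^esub> (b \<odot>\<^bsub>A\<^esub> \<one>\<^bsub>A\<^esub>) = inv\<^bsub>F\<^esub> b \<odot>\<^bsub>A\<^esub> \<one>\<^bsub>A\<^esub>"
    by (auto simp: Units_def intro: inv_char)
qed

lemma algebra_imp_assoc_algebra:
  assumes "algebra F K"
  shows "assoc_algebra F K"
proof -
  interpret K: cring K
    using assms by (rule algebra.M_cring)
  note smult = module.smult_closed[OF algebra.module[OF assms]] algebra.smult_assoc2[OF assms]
  have "x \<otimes>\<^bsub>K\<^esub> (a \<odot>\<^bsub>K\<^esub> y) = a \<odot>\<^bsub>K\<^esub> (x \<otimes>\<^bsub>K\<^esub> y)"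
    if "a \<in> carrier F" "x \<in> carrier K" "y \<in> carrier K" for a x y
    using that smult K.m_comm by metis
  then have "unital_algebra F K"
    by (intro unital_algebra.intro[OF algebra.module[OF assms]] unital_algebra_axioms.intro)
      (simp_all add: K.l_distr K.r_distr smult)
  then show ?thesis
    using K.ring_axioms by (rule assoc_algebra.intro)
qed

lemma inv_into_conjugate:
  assumes "k \<in> alg_isos F A B" "x \<in> carrier A"
    and "\<forall>y \<in> carrier B. p y = (f \<circ> s \<circ> inv_into (carrier A) k) y"
  shows "p (k x) = f (s x)"
  using assms alg_isosD(1,6)[OF assms(1)] by (simp add: bij_betw_def)


theorem theorem2p6:
  fixes F :: "('f, 'n) ring_scheme"
  assumes "field F"
  shows
    "(\<forall>(D :: ('f, 'd, 'm) module_scheme) (D' :: ('f, 'e, 'k) module_scheme)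
        (g :: 'd \<Rightarrow> 'e) (h :: 'd \<Rightarrow> 'e) (c :: 'd)
        (\<sigma> :: nat \<Rightarrow> 'd \<Rightarrow> 'd) (\<phi> :: nat \<Rightarrow> 'e \<Rightarrow> 'e) (b :: 'f).
        central_simple_algebra F D \<and> central_simple_algebra F D' \<and>
        g \<in> alg_isos F D D' \<and> h \<in> alg_isos F D D' \<and>
        c \<in> Units D \<and>
        (\<forall>i \<in> {1, 2, 3, 4}. \<sigma> i \<in> alg_auts F D \<and> \<phi> i \<in> alg_auts F D') \<and>
        b \<in> Units F \<and>
        (\<forall>i \<in> {1, 2}. \<forall>y \<in> carrier D'. \<phi> i y = (g \<circ> \<sigma> i \<circ> inv_into (carrier D) h) y) \<and>
        (\<forall>i \<in> {3, 4}. \<forall>y \<in> carrier D'. \<phi> i y = (h \<circ> \<sigma> i \<circ> inv_into (carrier D) g) y)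
        \<longrightarrow>
        (\<lambda>(u, v). (g u, inv\<^bsub>F\<^esub> b \<odot>\<^bsub>D'\<^esub> h v))
          \<in> alg_isos F
              (Cay D c (\<sigma> 1) (\<sigma> 2) (\<sigma> 3) (\<sigma> 4))
              (Cay D' ((b [^]\<^bsub>F\<^esub> (2::nat)) \<odot>\<^bsub>D'\<^esub> g c) (\<phi> 1) (\<phi> 2) (\<phi> 3) (\<phi> 4)))
     \<and>
     (\<forall>(K :: ('f, 'd, 'm) module_scheme) (L :: ('f, 'e, 'k) module_scheme)
        (g :: 'd \<Rightarrow> 'e) (h :: 'd \<Rightarrow> 'e) (c :: 'd)
        (\<sigma> :: nat \<Rightarrow> 'd \<Rightarrow> 'd) (\<phi> :: nat \<Rightarrow> 'e \<Rightarrow> 'e) (b :: 'e).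
        finite_field_extension F K \<and> finite_field_extension F L \<and>
        g \<in> alg_isos F K L \<and> h \<in> alg_isos F K L \<and>
        c \<in> Units K \<and>
        (\<forall>i \<in> {1, 2, 3, 4}. \<sigma> i \<in> alg_auts F K \<and> \<phi> i \<in> alg_auts F L) \<and>
        b \<in> Units L \<and>
        (\<forall>i \<in> {1, 2}. \<forall>y \<in> carrier L. \<phi> i y = (g \<circ> \<sigma> i \<circ> inv_into (carrier K) h) y) \<and>
        (\<forall>i \<in> {3, 4}. \<forall>y \<in> carrier L. \<phi> i y = (h \<circ> \<sigma> i \<circ> inv_into (carrier K) g) y)
        \<longrightarrow>
        (\<lambda>(u, v). (g u, h v \<otimes>\<^bsub>L\<^esub> inv\<^bsub>L\<^esub> b))
          \<in> alg_isos F
              (Cay K c (\<sigma> 1) (\<sigma> 2) (\<sigma> 3) (\<sigma> 4))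
              (Cay L (g c \<otimes>\<^bsub>L\<^esub> \<phi> 1 b \<otimes>\<^bsub>L\<^esub> \<phi> 2 b) (\<phi> 1) (\<phi> 2) (\<phi> 3) (\<phi> 4)))"
proof ((intro conjI allI impI; elim conjE), goal_cases)
  case (1 D D' g h c \<sigma> \<phi> b)
  interpret D: central_simple_algebra F D by fact
  interpret D': central_simple_algebra F D' by fact
  have iso: "g \<in> alg_isos F D D'" "h \<in> alg_isos F D D'"
    by fact+
  have auts: "\<sigma> i \<in> alg_auts F D" "\<phi> i \<in> alg_auts F D'" if "i \<in> {1, 2, 3, 4}" for i
    using \<open>\<forall>i \<in> {1, 2, 3, 4}. \<sigma> i \<in> alg_auts F D \<and> \<phi> i \<in> alg_auts F D'\<close> that
    by (simp_all only:)
  have hg: "\<phi> i (h x) = g (\<sigma> i x)" if "i \<in> {1, 2}" "x \<in> carrier D" for i x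
    using bspec[OF \<open>\<forall>i \<in> {1, 2}. \<forall>y \<in> carrier D'. \<phi> i y = (g \<circ> \<sigma> i \<circ> inv_into (carrier D) h) y\<close> that(1)]
    by (rule inv_into_conjugate[OF iso(2) that(2)])
  have gh: "\<phi> i (g x) = h (\<sigma> i x)" if "i \<in> {3, 4}" "x \<in> carrier D" for i x
    using bspec[OF \<open>\<forall>i \<in> {3, 4}. \<forall>y \<in> carrier D'. \<phi> i y = (h \<circ> \<sigma> i \<circ> inv_into (carrier D) g) y\<close> that(1)]
    by (rule inv_into_conjugate[OF iso(1) that(2)])
  let ?d = "b \<odot>\<^bsub>D'\<^esub> \<one>\<^bsub>D'\<^esub>"
  have b: "b \<in> carrier F" "inv\<^bsub>F\<^esub> b \<in> carrier F"
    using \<open>b \<in> Units F\<close> by (simp_all add: D.R.Units_closed)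
  have g: "g x \<in> carrier D'" and h: "h x \<in> carrier D'" if "x \<in> carrier D" for x
    using that iso by (auto dest: alg_isosD(1))
  have c: "c \<in> carrier D"
    using \<open>c \<in> Units D\<close> by (rule D.Units_closed)
  have fixed: "\<phi> i ?d = ?d" if "i \<in> {1, 2, 3, 4}" for i
    using b alg_isosD(4,5)[OF auts(2)[OF that]] by simp
  have "inv\<^bsub>F\<^esub> b \<odot>\<^bsub>D'\<^esub> h v = h v \<otimes>\<^bsub>D'\<^esub> inv\<^bsub>D'\<^esub> ?d" if "v \<in> carrier D" for v
    using \<open>b \<in> Units F\<close> b h[OF that] by (simp add: D'.scalar_unit D'.smult_mult_r)
  then have "(\<lambda>(u, v). (g u, inv\<^bsub>F\<^esub> b \<odot>\<^bsub>D'\<^esub> h v))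
      \<in> alg_isos F (Cay D c (\<sigma> 1) (\<sigma> 2) (\<sigma> 3) (\<sigma> 4))
         (Cay D' (g c \<otimes>\<^bsub>D'\<^esub> \<phi> 1 ?d \<otimes>\<^bsub>D'\<^esub> \<phi> 2 ?d) (\<phi> 1) (\<phi> 2) (\<phi> 3) (\<phi> 4))"
    using \<open>b \<in> Units F\<close> b c
    by (intro Cay_isomorphism[where h = h and d = ?d] D.assoc_algebra_axioms D'.assoc_algebra_axioms
        iso auts hg gh D'.scalar_unit D'.scalar_in_ring_center) simp_all
  moreover have "g c \<otimes>\<^bsub>D'\<^esub> \<phi> 1 ?d \<otimes>\<^bsub>D'\<^esub> \<phi> 2 ?d = (b [^]\<^bsub>F\<^esub> (2::nat)) \<odot>\<^bsub>D'\<^esub> g c"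
    using b g[OF c] by (simp add: fixed D'.smult_mult_r D'.smult_assoc1 numeral_2_eq_2)
  ultimately show ?case
    by simp
next
  case (2 K L g h c \<sigma> \<phi> b)
  interpret K: finite_field_extension F K by fact
  interpret L: finite_field_extension F L by fact
  have iso: "g \<in> alg_isos F K L" "h \<in> alg_isos F K L"
    by fact+
  have auts: "\<sigma> i \<in> alg_auts F K" "\<phi> i \<in> alg_auts F L" if "i \<in> {1, 2, 3, 4}" for i
    using \<open>\<forall>i \<in> {1, 2, 3, 4}. \<sigma> i \<in> alg_auts F K \<and> \<phi> i \<in> alg_auts F L\<close> that
    by (simp_all only:)
  have hg: "\<phi> i (h x) = g (\<sigma> i x)" if "i \<in> {1, 2}" "x \<in> carrier K" for i x
    using bspec[OF \<open>\<forall>i \<in> {1, 2}. \<forall>y \<in> carrier L. \<phi> i y = (g \<circ> \<sigma> i \<circ> inv_into (carrier K) h) y\<close> that(1)]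
    by (rule inv_into_conjugate[OF iso(2) that(2)])
  have gh: "\<phi> i (g x) = h (\<sigma> i x)" if "i \<in> {3, 4}" "x \<in> carrier K" for i x
    using bspec[OF \<open>\<forall>i \<in> {3, 4}. \<forall>y \<in> carrier L. \<phi> i y = (h \<circ> \<sigma> i \<circ> inv_into (carrier K) g) y\<close> that(1)]
    by (rule inv_into_conjugate[OF iso(1) that(2)])
  have c: "c \<in> carrier K"
    using \<open>c \<in> Units K\<close> by (rule K.Units_closed)
  have b: "b \<in> Units L" "b \<in> ring_center L"
    using \<open>b \<in> Units L\<close> L.m_comm L.Units_closed by (auto simp: ring_center_def)
  show ?case
    by (intro Cay_isomorphism[where h = h and d = b] algebra_imp_assoc_algebra
        K.algebra_axioms L.algebra_axioms
        iso auts hg gh b c) simp_all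
qed

end
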